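(* Let $n\ge 1$ and let $\rho=\sum_{\vec\mu} r_{\vec\mu}P_{\vec\mu}$ be a $\sigma$-diagonal state on $\mathbb{C}^{2^n}\otimes\mathbb{C}^{2^n}$. If $\rho$ is entangled, then its entanglement is witnessed by a diagonal positive map, i.e. there exists a positive linear map $\Lambda:M_{2^n}(\mathbb{C})\to M_{2^n}(\mathbb{C})$ of the form $$\Lambda[X]=\sum_{\vec\mu}\lambda_{\vec\mu\vec\mu}\,\sigma_{\vec\mu}X\sigma_{\vec\mu}$$ such that $(\mathrm{id}_{2^n}\otimes\Lambda)[\rho]$ is not positive semidefinite.
   Context: $\sigma_0=\mathbb{1}_2$ and $\sigma_1,\sigma_2,\sigma_3$ are the Pauli matrices. For $\vec\mu=(\mu_1,\dots,\mu_n)\in\{0,1,2,3\}^n$ put $\sigma_{\vec\mu}=\sigma_{\mu_1}\otimes\cdots\otimes\sigma_{\mu_n}\in M_{2^n}(\mathbb{C})$. Let $|\Psi_+\rangle=\frac{1}{\sqrt{2^n}}\sum_{j=1}^{2^n}|j\rangle\otimes|j\rangle$ with $\{|j\rangle\}$ the standard basis of $\mathbb{C}^{2^n}$, $|\Psi_{\vec\mu}\rangle=(\mathbb{1}\otimes\sigma_{\vec\mu})|\Psi_+\rangle$ and $P_{\vec\mu}=|\Psi_{\vec\mu}\rangle\langle\Psi_{\vec\mu}|$; the $|\Psi_{\vec\mu}\rangle$ form an orthonormal basis of $\mathbb{C}^{2^n}\otimes\mathbb{C}^{2^n}$. A $\sigma$-diagonal state is a density matrix $\rho=\sum_{\vec\mu}r_{\vec\mu}P_{\vec\mu}$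 with $0\le r_{\vec\mu}\le1$, $\sum_{\vec\mu}r_{\vec\mu}=1$. A state is separable if it is a convex combination of product states $\rho^1\otimes\rho^2$, and entangled otherwise. A linear map is positive if it sends positive semidefinite matrices to positive semidefinite matrices. A positive map $\Lambda$ witnesses the entanglement of $\rho$ if $(\mathrm{id}\otimes\Lambda)[\rho]\not\ge0$. *)

theory Defs
  imports "HOL-Analysis.Analysis"
begin

text \<open>
  A system of \<open>n \<ge> 1\<close> qubits is indexed by a finite type \<open>'n\<close> with \<open>n = CARD('n)\<close>: the standard
  basis of the \<open>2^n\<close>-dimensional space is labelled by the bit strings \<open>'n \<Rightarrow> 2\<close>, and Pauli
  multi-indices are the functions \<open>'n \<Rightarrow> 4\<close>, the elements of type \<open>4\<close> being \<open>0, 1, 2, 3\<close>.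
  The index type of a tensor product of two spaces is the product of the index types.
\<close>

type_synonym 'i cmat = "complex ^ 'i ^ 'i"


subsection \<open>Matrices\<close>

definition cscale :: "complex \<Rightarrow> 'i::finite cmat \<Rightarrow> 'i cmat" where
  "cscale c A = (\<chi> i j. c * A $ i $ j)"

definition vtensor :: "complex ^ 'a::finite \<Rightarrow> complex ^ 'b::finite \<Rightarrow> complex ^ ('a \<times> 'b)" where
  "vtensor u v = (\<chi> i. u $ fst i * v $ snd i)"

definition mtensor :: "'a::finite cmat \<Rightarrow> 'b::finite cmat \<Rightarrow> ('a \<times> 'b) cmat" where
  "mtensor A B = (\<chi> i j. A $ fst i $ fst j * B $ snd i $ snd j)"

definition ketbra :: "complex ^ 'i::finite \<Rightarrow> complex ^ 'i \<Rightarrow> 'i cmat" where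
  "ketbra u v = (\<chi> i j. u $ i * cnj (v $ j))"

text \<open>Membership in the nonnegative reals includes that the quadratic form is real-valued,
  so over the complex numbers Hermiticity is implied.\<close>

definition psd :: "'i::finite cmat \<Rightarrow> bool" where
  "psd A \<longleftrightarrow> (\<forall>x. (\<Sum>i\<in>UNIV. cnj (x $ i) * (A *v x) $ i) \<in> \<real>\<^sub>\<ge>\<^sub>0)"


subsection \<open>States\<close>

definition density_matrix :: "'i::finite cmat \<Rightarrow> bool" where
  "density_matrix \<rho> \<longleftrightarrow> psd \<rho> \<and> trace \<rho> = 1"

definition separable_state :: "('a::finite \<times> 'b::finite) cmat \<Rightarrow> bool" where
  "separable_state \<rho> \<longleftrightarrow>
     \<rho> \<in> convex hull {mtensor \<rho>1 \<rho>2 | \<rho>1 \<rho>2. density_matrix \<rho>1 \<and> density_matrix \<rho>2}"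

definition entangled :: "('a::finite \<times> 'b::finite) cmat \<Rightarrow> bool" where
  "entangled \<rho> \<longleftrightarrow> density_matrix \<rho> \<and> \<not> separable_state \<rho>"


subsection \<open>Maps on matrices\<close>

text \<open>The predicate \<^const>\<open>linear\<close> of the library expresses linearity over the reals only.\<close>

definition clinear_map :: "('a::finite cmat \<Rightarrow> 'b::finite cmat) \<Rightarrow> bool" where
  "clinear_map \<Lambda> \<longleftrightarrow>
     (\<forall>X Y. \<Lambda> (X + Y) = \<Lambda> X + \<Lambda> Y) \<and> (\<forall>c X. \<Lambda> (cscale c X) = cscale c (\<Lambda> X))"

definition positive_map :: "('a::finite cmat \<Rightarrow> 'b::finite cmat) \<Rightarrow> bool" where
  "positive_map \<Lambda> \<longleftrightarrow> clinear_map \<Lambda> \<and> (\<forall>X. psd X \<longrightarrow> psd (\<Lambda> X))"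

text \<open>\<open>id_tensor \<Lambda>\<close> is \<open>id \<otimes> \<Lambda>\<close>: writing \<open>M\<close> as the sum over \<open>a, b\<close> of \<open>E a b \<otimes> block a b M\<close> with
  matrix units \<open>E a b\<close>, it applies \<open>\<Lambda>\<close> to every block.  For linear \<open>\<Lambda>\<close> it is determined by its
  values on product matrices, given by \<open>id_tensor_mtensor\<close> below.\<close>

definition block :: "'a::finite \<Rightarrow> 'a \<Rightarrow> ('a \<times> 'b::finite) cmat \<Rightarrow> 'b cmat" where
  "block a b M = (\<chi> k l. M $ (a, k) $ (b, l))"

definition id_tensor ::
  "('b::finite cmat \<Rightarrow> 'c::finite cmat) \<Rightarrow> ('a::finite \<times> 'b) cmat \<Rightarrow> ('a \<times> 'c) cmat" where
  "id_tensor \<Lambda> M = (\<chi> i j. \<Lambda> (block (fst i) (fst j) M) $ snd i $ snd j)"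

lemma id_tensor_mtensor:
  assumes "clinear_map \<Lambda>"
  shows "id_tensor \<Lambda> (mtensor A B) = mtensor A (\<Lambda> B)"
proof -
  have "block a b (mtensor A B) = cscale (A $ a $ b) B" for a b
    by (simp add: block_def mtensor_def cscale_def)
  then show ?thesis
    using assms by (simp add: id_tensor_def mtensor_def clinear_map_def cscale_def)
qed

lemma id_tensor_add:
  assumes "clinear_map \<Lambda>"
  shows "id_tensor \<Lambda> (M + N) = id_tensor \<Lambda> M + id_tensor \<Lambda> N"
proof -
  have "block a b (M + N) = block a b M + block a b N" for a b
    by (simp add: block_def vec_eq_iff)
  then show ?thesis
    using assms unfolding clinear_map_def
    by (intro vec_eq_iff[THEN iffD2] allI) (simp add: id_tensor_def)
qed


subsection \<open>Pauli matrices\<close>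

definition pauli :: "4 \<Rightarrow> 2 cmat" where
  "pauli m =
    (if m = 0 then mat 1
     else if m = 1 then vector [vector [0, 1], vector [1, 0]]
     else if m = 2 then vector [vector [0, - \<i>], vector [\<i>, 0]]
     else vector [vector [1, 0], vector [0, - 1]])"

text \<open>The entries of an \<open>n\<close>-fold tensor product of matrices are the products of the entries of
  the factors.\<close>

definition pauli_string :: "('n::finite \<Rightarrow> 4) \<Rightarrow> ('n \<Rightarrow> 2) cmat" where
  "pauli_string \<mu> = (\<chi> a b. \<Prod>k\<in>UNIV. pauli (\<mu> k) $ a k $ b k)"

definition psi_plus :: "complex ^ (('n::finite \<Rightarrow> 2) \<times> ('n \<Rightarrow> 2))" where
  "psi_plus = complex_of_real (1 / sqrt (2 ^ CARD('n))) *s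
     (\<Sum>j\<in>UNIV. vtensor (axis j 1) (axis j 1))"

definition psi :: "('n::finite \<Rightarrow> 4) \<Rightarrow> complex ^ (('n \<Rightarrow> 2) \<times> ('n \<Rightarrow> 2))" where
  "psi \<mu> = mtensor (mat 1) (pauli_string \<mu>) *v psi_plus"

definition psi_proj :: "('n::finite \<Rightarrow> 4) \<Rightarrow> (('n \<Rightarrow> 2) \<times> ('n \<Rightarrow> 2)) cmat" where
  "psi_proj \<mu> = ketbra (psi \<mu>) (psi \<mu>)"

end

theory Submission
  imports Defs
begin

text \<open>
  Twirling with the operators \<open>\<sigma>\<^sub>\<nu>\<^sup>T \<otimes> \<sigma>\<^sub>\<nu>\<close> projects a state onto the span of the \<open>P\<^sub>\<mu>\<close>, because it
  multiplies each \<open>\<Psi>\<^sub>\<mu>\<close> by a sign and these signs tell the \<open>\<Psi>\<^sub>\<mu>\<close> apart; being an average of local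
  unitary conjugations, it maps product states to separable ones.  A hyperplane \<open>\<langle>W, X\<rangle> = c\<close>
  separating \<open>\<rho>\<close> from the compact convex set of separable states can therefore be replaced by its
  diagonal part: put \<open>w\<^sub>\<mu> = \<langle>W, P\<^sub>\<mu>\<rangle> - c\<close> and \<open>\<Lambda>[X] = \<Sum>\<^sub>\<mu> w\<^sub>\<mu> \<sigma>\<^sub>\<mu> X \<sigma>\<^sub>\<mu>\<close>.  Then
  \<open>\<langle>y|\<Lambda>[X]|y\<rangle>\<close> is \<open>2^n\<close> times \<open>\<Sum>\<^sub>\<mu> w\<^sub>\<mu> Tr (P\<^sub>\<mu> (Y \<otimes> X))\<close>, where \<open>Y\<close> is the complex conjugate of
  \<open>|y\<rangle>\<langle>y|\<close>, which is nonnegative because the twirl of \<open>Y \<otimes> X\<close> is separable up to a factor, while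
  \<open>\<langle>\<Psi>\<^sub>+|(id \<otimes> \<Lambda>)[\<rho>]|\<Psi>\<^sub>+\<rangle> = \<Sum>\<^sub>\<mu> w\<^sub>\<mu> r\<^sub>\<mu> = \<langle>W, \<rho>\<rangle> - c < 0\<close>.
\<close>

subsection \<open>Positive semidefinite matrices and separable states\<close>

lemma matrix_vector_mult_axis:
  "(A *v axis j b) $ k = A $ k $ j * b" for A :: "complex ^ 'n::finite ^ 'm::finite"
  by (simp add: matrix_vector_mult_def axis_def if_distrib[of "\<lambda>x. _ * x"] cong: if_cong)

lemma sum_cnj_axis: "(\<Sum>k\<in>UNIV. cnj (axis i b $ k) * f k) = cnj b * f i"
  by (simp add: axis_def if_distrib[of cnj] if_distrib[of "\<lambda>x. x * _"] cong: if_cong)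

text \<open>The quadratic form at \<open>e_i + b e_j\<close>. The choices \<open>b = 0\<close>,
  \<open>b = 1\<close>, \<open>b = \<i>\<close> and a suitable phase yield the entrywise facts about
  \<open>psd\<close> matrices used below.\<close>

lemma psd_two_axes:
  assumes "psd A"
  shows "A $ i $ i + A $ i $ j * b + cnj b * A $ j $ i + cnj b * A $ j $ j * b \<in> \<real>\<^sub>\<ge>\<^sub>0"
proof -
  have "(\<Sum>k\<in>UNIV. cnj ((axis i 1 + axis j b) $ k) * (A *v (axis i 1 + axis j b)) $ k)
      = A $ i $ i + A $ i $ j * b + cnj b * A $ j $ i + cnj b * A $ j $ j * b"
    by (simp add: matrix_vector_right_distrib matrix_vector_mult_axis sum.distrib
        ring_distribs sum_cnj_axis)
  with assms show ?thesis
    unfolding psd_def by metis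
qed

lemma psd_diagonal: "psd A \<Longrightarrow> A $ i $ i \<in> \<real>\<^sub>\<ge>\<^sub>0"
  using psd_two_axes[of A i i 0] by simp

text \<open>As the diagonal entries are real, \<open>b = 1\<close> makes the imaginary parts of the
  two entries cancel and \<open>b = \<i>\<close> makes their real parts agree.\<close>

lemma psd_hermitian:
  assumes "psd A"
  shows "cnj (A $ i $ j) = A $ j $ i"
  using psd_two_axes[OF assms, of i j 1] psd_two_axes[OF assms, of i j \<i>]
    psd_diagonal[OF assms, of i] psd_diagonal[OF assms, of j]
  by (simp add: complex_nonneg_Reals_iff complex_eq_iff)

lemma psd_trace_nonneg: "psd A \<Longrightarrow> trace A \<in> \<real>\<^sub>\<ge>\<^sub>0"
  using psd_diagonal[of A] by (simp add: complex_nonneg_Reals_iff trace_def sum_nonneg)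

text \<open>A suitable phase gives \<open>2 |A_ij| <= A_ii + A_jj\<close>, and each diagonal entry
  is at most the trace. Hence a \<open>psd\<close> matrix of trace zero vanishes, and density
  matrices are bounded.\<close>

lemma psd_norm_entry_le_trace:
  assumes "psd A"
  shows "norm (A $ i $ j) \<le> Re (trace A)"
proof -
  have d: "Re (A $ k $ k) \<le> Re (trace A)" for k
    using psd_diagonal[OF assms] unfolding trace_def Re_sum
    by (intro member_le_sum) (auto simp: complex_nonneg_Reals_iff)
  show ?thesis
  proof (cases "A $ i $ j = 0")
    case True
    with psd_trace_nonneg[OF assms] show ?thesis
      by (simp add: complex_nonneg_Reals_iff)
  next
    case False
    \<comment> \<open>the phase for which \<open>e\<^sub>i + b e\<^sub>j\<close> turns \<open>A\<^sub>i\<^sub>j\<close> into \<open>- \<bar>A\<^sub>i\<^sub>j\<bar>\<close>\<close>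
    define b where "b = - cnj (A $ i $ j) / norm (A $ i $ j)"
    have b: "A $ i $ j * b = - complex_of_real (norm (A $ i $ j))"
      using False by (simp add: b_def complex_norm_square[symmetric] mult.commute[of "cnj _"]
          power2_eq_square field_simps flip: of_real_mult)
    have b': "cnj b * A $ j $ i = - complex_of_real (norm (A $ i $ j))"
      using arg_cong[OF b, of cnj] by (simp add: psd_hermitian[OF assms] mult.commute)
    have "cnj b * b = 1"
      using False by (simp add: b_def complex_norm_square[symmetric] mult.commute[of "cnj _"]
          power2_eq_square field_simps flip: of_real_mult)
    then have b'': "cnj b * A $ j $ j * b = A $ j $ j"
      by (metis mult.assoc mult.commute mult_1)
    show ?thesis
      using psd_two_axes[OF assms, of i j b] d[of i] d[of j]
      unfolding b b' b'' by (simp add: complex_nonneg_Reals_iff)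
  qed
qed

lemma psd_scaleR:
  assumes "psd A" and "0 \<le> t"
  shows "psd (t *\<^sub>R A)"
proof -
  have "(\<Sum>i\<in>UNIV. cnj (x $ i) * ((t *\<^sub>R A) *v x) $ i)
      = of_real t * (\<Sum>i\<in>UNIV. cnj (x $ i) * (A *v x) $ i)" for x
    by (simp add: matrix_vector_mult_def scaleR_conv_of_real[where 'a = complex]
        sum_distrib_left mult_ac)
  with assms show ?thesis by (simp add: psd_def)
qed

lemma trace_scaleR: "trace (t *\<^sub>R A) = t *\<^sub>R trace A" for A :: "'i::finite cmat"
  by (simp add: trace_def scaleR_sum_right)

text \<open>Dividing by the trace reduces homogeneous claims about positive matrices to density
  matrices, the only ones that separability speaks of.\<close>

lemma psd_cases:
  assumes "psd A"
  obtains "A = 0" | t \<rho> where "0 < t" "density_matrix \<rho>" "A = t *\<^sub>R \<rho>"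
proof -
  have tr: "trace A = of_real (Re (trace A))" "0 \<le> Re (trace A)"
    using psd_trace_nonneg[OF assms] by (simp_all add: complex_nonneg_Reals_iff complex_eq_iff)
  show thesis
  proof (cases "Re (trace A) = 0")
    case True
    then have "A = 0"
      using psd_norm_entry_le_trace[OF assms] by (simp add: vec_eq_iff)
    then show thesis by (rule that)
  next
    case False
    define t where "t = Re (trace A)"
    have t: "0 < t" and trace: "trace A = of_real t"
      using False tr by (auto simp: t_def)
    have "density_matrix ((1 / t) *\<^sub>R A)"
      using t assms by (simp add: density_matrix_def psd_scaleR trace_scaleR trace
          scaleR_conv_of_real[where 'a = complex])
    with t show thesis
      by (intro that(2)[of t "(1 / t) *\<^sub>R A"]) auto
  qed
qed

lemma psd_ketbra: "psd (ketbra u u)"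
proof -
  have "(\<Sum>i\<in>UNIV. cnj (x $ i) * (ketbra u u *v x) $ i)
      = of_real ((norm (\<Sum>i\<in>UNIV. cnj (u $ i) * x $ i))\<^sup>2)" for x
    unfolding complex_norm_square
    by (simp add: ketbra_def matrix_vector_mult_def sum_product mult_ac sum_distrib_left)
      (rule sum.swap)
  then show ?thesis by (simp add: psd_def)
qed

text \<open>A Hermitian \<open>U\<close> moves to the other side of the inner product, so the form
  at \<open>x\<close> becomes the form of \<open>A\<close> at \<open>U *v x\<close>.\<close>

lemma psd_conjugate:
  assumes "psd A" and U: "\<And>i j. cnj (U $ i $ j) = U $ j $ i"
  shows "psd (U ** A ** U)"
proof -
  have "(\<Sum>i\<in>UNIV. cnj (x $ i) * (U *v y) $ i) = (\<Sum>i\<in>UNIV. cnj ((U *v x) $ i) * y $ i)" for x y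
    unfolding matrix_vector_mult_def
    by (simp add: sum_distrib_left sum_distrib_right U mult_ac) (rule sum.swap)
  then show ?thesis
    using assms(1) by (simp add: psd_def flip: matrix_vector_mul_assoc)
qed

lemma density_matrix_conjugate:
  assumes "density_matrix A" and "\<And>i j. cnj (U $ i $ j) = U $ j $ i" and "U ** U = mat 1"
  shows "density_matrix (U ** A ** U)"
proof -
  have "trace (U ** A ** U) = trace (U ** U ** A)"
    by (metis trace_mul_sym matrix_mul_assoc)
  with assms show ?thesis by (simp add: density_matrix_def psd_conjugate)
qed

section \<open>Compactness of the sets of density matrices and of separable states\<close>

lemma closed_psd: "closed {A :: 'i::finite cmat. psd A}"
proof -
  have "closed {A :: 'i cmat. (\<Sum>i\<in>UNIV. cnj (x $ i) * (A *v x) $ i) \<in> \<real>\<^sub>\<ge>\<^sub>0}" for x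
    unfolding matrix_vector_mult_def
    by (intro closed_vimage[OF closed_nonneg_Reals_complex, unfolded vimage_def])
       (auto intro!: continuous_intros)
  then show ?thesis
    unfolding psd_def by (rule closed_Collect_all)
qed

lemma compact_density_matrices: "compact {A :: 'i::finite cmat. density_matrix A}"
proof (rule compact_eq_bounded_closed[THEN iffD2], rule conjI)
  have "norm A \<le> (\<Sum>i\<in>(UNIV::'i set). \<Sum>j\<in>(UNIV::'i set). 1)" if "density_matrix A" for A :: "'i cmat"
  proof -
    have "norm A \<le> (\<Sum>i\<in>UNIV. norm (A $ i))"
      by (simp add: norm_vec_def[of A] L2_set_le_sum)
    also have "\<dots> \<le> (\<Sum>i\<in>UNIV. \<Sum>j\<in>UNIV. norm (A $ i $ j))"
      by (intro sum_mono) (simp add: norm_vec_def L2_set_le_sum)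
    also have "\<dots> \<le> (\<Sum>i\<in>(UNIV::'i set). \<Sum>j\<in>(UNIV::'i set). 1)"
      using that psd_norm_entry_le_trace[of A] by (intro sum_mono) (simp add: density_matrix_def)
    finally show ?thesis .
  qed
  then show "bounded {A :: 'i cmat. density_matrix A}"
    unfolding bounded_iff by blast
  have "closed {A :: 'i cmat. trace A = 1}"
    unfolding trace_def by (intro closed_Collect_eq continuous_intros)
  with closed_psd show "closed {A :: 'i cmat. density_matrix A}"
    unfolding density_matrix_def by (rule closed_Collect_conj)
qed

text \<open>Product states form a continuous image of a compact set, and in finite dimension the
  convex hull of a compact set is compact. The resulting closedness permits strict
  separation.\<close>

lemma compact_separable_states:
  "compact {\<rho> :: ('a::finite \<times> 'b::finite) cmat. separable_state \<rho>}"
proof -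
  have "{mtensor \<rho>1 \<rho>2 | (\<rho>1 :: 'a cmat) (\<rho>2 :: 'b cmat). density_matrix \<rho>1 \<and> density_matrix \<rho>2}
      = (\<lambda>(\<rho>1, \<rho>2). mtensor \<rho>1 \<rho>2) ` ({\<rho>. density_matrix \<rho>} \<times> {\<rho>. density_matrix \<rho>})"
    by auto
  moreover have "compact \<dots>"
    unfolding mtensor_def case_prod_unfold
    by (intro compact_continuous_image compact_Times compact_density_matrices continuous_intros)
  ultimately show ?thesis
    unfolding separable_state_def by (simp add: compact_convex_hull)
qed

lemma trace_mtensor: "trace (mtensor A B) = trace A * trace B"
  by (simp add: trace_def mtensor_def sum_product sum.cartesian_product case_prod_unfold
      UNIV_Times_UNIV[symmetric] del: UNIV_Times_UNIV)


subsection \<open>Pauli strings\<close>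

text \<open>\<open>exhaust_4\<close> lists the elements of type \<open>4\<close> as
  \<open>1, 2, 3, 4\<close> with \<open>4 = 0\<close>, so \<open>pauli 4\<close> is the identity;
  likewise the indices of type \<open>2\<close> appear as \<open>1\<close> and
  \<open>2 = 0\<close>.\<close>

lemma pauli_entries:
  "pauli 1 $ 1 $ 1 = 0" "pauli 1 $ 1 $ 2 = 1" "pauli 1 $ 2 $ 1 = 1" "pauli 1 $ 2 $ 2 = 0"
  "pauli 2 $ 1 $ 1 = 0" "pauli 2 $ 1 $ 2 = - \<i>" "pauli 2 $ 2 $ 1 = \<i>" "pauli 2 $ 2 $ 2 = 0"
  "pauli 3 $ 1 $ 1 = 1" "pauli 3 $ 1 $ 2 = 0" "pauli 3 $ 2 $ 1 = 0" "pauli 3 $ 2 $ 2 = - 1"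
  "pauli 4 $ 1 $ 1 = 1" "pauli 4 $ 1 $ 2 = 0" "pauli 4 $ 2 $ 1 = 0" "pauli 4 $ 2 $ 2 = 1"
  by (simp_all add: pauli_def mat_def)

lemma pauli_hermitian: "cnj (pauli m $ a $ b) = pauli m $ b $ a"
  using exhaust_4[of m] exhaust_2[of a] exhaust_2[of b] by (auto simp: pauli_entries)

lemma pauli_involution:
  "(\<Sum>b\<in>UNIV. pauli m $ a $ b * pauli m $ b $ c) = (if a = c then 1 else 0)"
  using exhaust_4[of m] exhaust_2[of a] exhaust_2[of c]
  by (auto simp: pauli_entries sum_2)

lemma pauli_orthogonal:
  "(\<Sum>a\<in>UNIV. \<Sum>b\<in>UNIV. pauli m $ a $ b * pauli m' $ b $ a) = (if m = m' then 2 else 0)"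
  using exhaust_4[of m] exhaust_4[of m'] by (auto simp: pauli_entries sum_2)

text \<open>The entrywise form, for one qubit, of the statement that twirling projects onto the span of
  the \<open>P\<^sub>m\<close>: the products of two factors are entries of \<open>2 P\<^sub>m\<close> on the left and of
  \<open>\<sigma>\<^sub>m\<^sup>T \<otimes> \<sigma>\<^sub>m\<close> on the right.\<close>

lemma pauli_twirl:
  "(\<Sum>m\<in>UNIV. pauli m $ a1 $ b1 * pauli m $ b2 $ a2 * (pauli m $ a3 $ b3 * pauli m $ b4 $ a4)) =
   (\<Sum>m\<in>UNIV. pauli m $ b2 $ b3 * pauli m $ a3 $ a2 * (pauli m $ b4 $ b1 * pauli m $ a1 $ a4))"
  using exhaust_2[of a1] exhaust_2[of a2] exhaust_2[of a3] exhaust_2[of a4]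
    exhaust_2[of b1] exhaust_2[of b2] exhaust_2[of b3] exhaust_2[of b4]
  by (elim disjE) (simp_all add: pauli_entries sum_4)

text \<open>Distributivity over all bit strings or multi-indices at once; it reduces the identities
  for Pauli strings to a single qubit.\<close>

lemma sum_fun_prod:
  fixes f :: "'n::finite \<Rightarrow> 'm::finite \<Rightarrow> 'c::comm_semiring_1"
  shows "(\<Sum>g\<in>UNIV. \<Prod>k\<in>UNIV. f k (g k)) = (\<Prod>k\<in>UNIV. \<Sum>m\<in>UNIV. f k m)"
  using prod_sum_PiE[of "UNIV :: 'n set" "\<lambda>_. UNIV" f] by (simp add: PiE_UNIV_domain)

lemma prod_delta_fun:
  fixes f g :: "'n::finite \<Rightarrow> 'b" and c :: "'c::comm_semiring_1"
  shows "(\<Prod>k\<in>UNIV. if f k = g k then c else 0) = (if f = g then c ^ CARD('n) else 0)"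
proof (cases "f = g")
  case False
  then obtain k where "f k \<noteq> g k" by blast
  then have "(\<Prod>k\<in>UNIV. if f k = g k then c else 0) = 0"
    by (intro prod_zero) auto
  with False show ?thesis by simp
qed simp

lemma pauli_string_hermitian: "cnj (pauli_string \<mu> $ a $ b) = pauli_string \<mu> $ b $ a"
  by (simp add: pauli_string_def pauli_hermitian)

lemma pauli_string_involution: "pauli_string \<mu> ** pauli_string \<mu> = mat 1"
proof -
  have "(\<Sum>b\<in>UNIV. pauli_string \<mu> $ a $ b * pauli_string \<mu> $ b $ c) = (if a = c then 1 else 0)" for a c
    unfolding pauli_string_def vec_lambda_beta prod.distrib[symmetric]
      sum_fun_prod[of "\<lambda>k m. pauli (\<mu> k) $ a k $ m * pauli (\<mu> k) $ m $ c k"]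
      pauli_involution prod_delta_fun by simp
  then show ?thesis
    by (simp add: matrix_matrix_mult_def mat_def)
qed

lemma pauli_string_orthogonal:
  fixes \<mu> \<nu> :: "'n::finite \<Rightarrow> 4"
  shows "(\<Sum>a\<in>UNIV. \<Sum>b\<in>UNIV. pauli_string \<mu> $ a $ b * pauli_string \<nu> $ b $ a) =
     (if \<mu> = \<nu> then 2 ^ CARD('n) else 0)"
  unfolding pauli_string_def vec_lambda_beta prod.distrib[symmetric]
    sum_fun_prod[of "\<lambda>k m. pauli (\<mu> k) $ a k $ m * pauli (\<nu> k) $ m $ a k" for a]
    sum_fun_prod[of "\<lambda>k m. \<Sum>b\<in>UNIV. pauli (\<mu> k) $ m $ b * pauli (\<nu> k) $ b $ m"]
    pauli_orthogonal prod_delta_fun ..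

lemma pauli_string_twirl:
  fixes a1 a2 a3 a4 b1 b2 b3 b4 :: "'n::finite \<Rightarrow> 2"
  shows "(\<Sum>\<mu>\<in>UNIV. pauli_string \<mu> $ a1 $ b1 * pauli_string \<mu> $ b2 $ a2 *
      (pauli_string \<mu> $ a3 $ b3 * pauli_string \<mu> $ b4 $ a4)) =
   (\<Sum>\<mu>\<in>UNIV. pauli_string \<mu> $ b2 $ b3 * pauli_string \<mu> $ a3 $ a2 *
      (pauli_string \<mu> $ b4 $ b1 * pauli_string \<mu> $ a1 $ a4))"
proof -
  have factor: "(\<Sum>\<mu>\<in>UNIV. pauli_string \<mu> $ a $ b * pauli_string \<mu> $ c $ d *
      (pauli_string \<mu> $ e $ f * pauli_string \<mu> $ g $ h)) =
    (\<Prod>k\<in>UNIV. \<Sum>m\<in>UNIV. pauli m $ a k $ b k * pauli m $ c k $ d k *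
      (pauli m $ e k $ f k * pauli m $ g k $ h k))" for a b c d e f g h :: "'n \<Rightarrow> 2"
    unfolding pauli_string_def vec_lambda_beta prod.distrib[symmetric]
    by (rule sum_fun_prod[of "\<lambda>k m. pauli m $ a k $ b k * pauli m $ c k $ d k *
      (pauli m $ e k $ f k * pauli m $ g k $ h k)"])
  show ?thesis
    unfolding factor by (intro prod.cong refl pauli_twirl)
qed

section \<open>Entries of the maximally entangled vectors and their projections\<close>

lemma psi_plus_entries:
  "psi_plus $ j = complex_of_real (1 / sqrt (2 ^ CARD('n))) * (if fst j = snd j then 1 else 0)"
  for j :: "('n::finite \<Rightarrow> 2) \<times> ('n \<Rightarrow> 2)"
  by (simp add: psi_plus_def vtensor_def axis_def if_distrib[of "\<lambda>x. x * _"] cong: if_cong)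

lemma normalization_squared:
  "complex_of_real (1 / sqrt (2 ^ n)) * complex_of_real (1 / sqrt (2 ^ n)) = 1 / 2 ^ n"
  by (simp flip: of_real_mult)

lemma psi_entries:
  "psi \<mu> $ i = complex_of_real (1 / sqrt (2 ^ CARD('n))) * pauli_string \<mu> $ snd i $ fst i"
  for \<mu> :: "'n::finite \<Rightarrow> 4"
proof -
  have "psi \<mu> $ i = (\<Sum>a\<in>UNIV. \<Sum>k\<in>UNIV. if k = a \<and> fst i = a then
      complex_of_real (1 / sqrt (2 ^ CARD('n))) * pauli_string \<mu> $ snd i $ fst i else 0)"
    unfolding psi_def matrix_vector_mult_def vec_lambda_beta sum.cartesian_product UNIV_Times_UNIV
    by (intro sum.cong) (auto simp: psi_plus_entries mtensor_def mat_def)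
  also have "\<dots> = (\<Sum>a\<in>UNIV. if fst i = a then
      complex_of_real (1 / sqrt (2 ^ CARD('n))) * pauli_string \<mu> $ snd i $ fst i else 0)"
    by (intro sum.cong refl) simp
  finally show ?thesis by simp
qed

text \<open>Hermiticity trades the conjugate in the second factor for a transposed entry, which
  keeps later computations free of conjugation.\<close>

lemma psi_proj_entries:
  "psi_proj \<mu> $ i $ j =
     pauli_string \<mu> $ snd i $ fst i * pauli_string \<mu> $ fst j $ snd j / 2 ^ CARD('n)"
  for \<mu> :: "'n::finite \<Rightarrow> 4"
  using normalization_squared[of "CARD('n)"]
  by (simp add: psi_proj_def ketbra_def psi_entries pauli_string_hermitian)


subsection \<open>Twirling\<close>

lemma sum_UNIV_prod:
  "(\<Sum>x\<in>UNIV. f x) = (\<Sum>a\<in>UNIV. \<Sum>b\<in>UNIV. f (a, b))"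
  for f :: "'a::finite \<times> 'b::finite \<Rightarrow> 'c::comm_monoid_add"
  by (simp add: sum.cartesian_product)

lemma sum_rotate:
  "(\<Sum>a\<in>A. \<Sum>b\<in>B. \<Sum>c\<in>C. f a b c) = (\<Sum>b\<in>B. \<Sum>c\<in>C. \<Sum>a\<in>A. f a b c)"
  by (subst sum.swap, intro sum.cong refl, rule sum.swap)

text \<open>Up to normalization \<open>psi \<mu>\<close> is the matrix
  \<open>pauli_string \<mu>\<close> read as a vector, and conjugating \<open>y\<close> makes up for
  the transpose on the first tensor factor. Positivity of a diagonal map thus becomes an inequality
  about product matrices.\<close>

lemma trace_psi_proj_mtensor:
  fixes \<mu> :: "'n::finite \<Rightarrow> 4"
  shows "trace (psi_proj \<mu> ** mtensor (ketbra (\<chi> i. cnj (y $ i)) (\<chi> i. cnj (y $ i))) X) =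
    (\<Sum>i\<in>UNIV. cnj (y $ i) * ((pauli_string \<mu> ** X ** pauli_string \<mu>) *v y) $ i) / 2 ^ CARD('n)"
proof -
  let ?S = "\<lambda>a b. pauli_string \<mu> $ a $ b"
  have "trace (psi_proj \<mu> ** mtensor (ketbra (\<chi> i. cnj (y $ i)) (\<chi> i. cnj (y $ i))) X) =
    (\<Sum>q\<in>UNIV. \<Sum>p\<in>UNIV. ?S (snd q) (fst q) * ?S (fst p) (snd p) *
       (cnj (y $ fst p) * y $ fst q * X $ snd p $ snd q)) / 2 ^ CARD('n)"
    by (simp add: trace_def matrix_matrix_mult_def psi_proj_entries mtensor_def ketbra_def
        sum_divide_distrib)
  also have "(\<Sum>q\<in>UNIV. \<Sum>p\<in>UNIV. ?S (snd q) (fst q) * ?S (fst p) (snd p) *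
       (cnj (y $ fst p) * y $ fst q * X $ snd p $ snd q)) =
    (\<Sum>b\<in>UNIV. \<Sum>l\<in>UNIV. \<Sum>a\<in>UNIV. \<Sum>k\<in>UNIV.
       ?S k a * ?S b l * (cnj (y $ b) * y $ a * X $ l $ k))"
    by (subst sum.swap) (simp add: sum_UNIV_prod)
  also have "\<dots> = (\<Sum>b\<in>UNIV. \<Sum>l\<in>UNIV. \<Sum>k\<in>UNIV. \<Sum>a\<in>UNIV.
       ?S k a * ?S b l * (cnj (y $ b) * y $ a * X $ l $ k))"
    by (intro sum.cong refl sum.swap)
  also have "\<dots> = (\<Sum>i\<in>UNIV. cnj (y $ i) * ((pauli_string \<mu> ** X ** pauli_string \<mu>) *v y) $ i)"
    unfolding matrix_vector_mul_assoc[symmetric] unfolding matrix_vector_mult_def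
    by (simp add: sum_distrib_left mult_ac)
  finally show ?thesis .
qed

lemma trace_psi_proj: "trace (psi_proj \<mu>) = 1"
  using pauli_string_orthogonal[of \<mu> \<mu>]
  unfolding trace_def psi_proj_entries sum_divide_distrib[symmetric]
  by (simp add: sum_UNIV_prod mult.commute)

text \<open>The diagonal part of a product matrix is the average of its local conjugates:
  \<open>pauli_string_twirl\<close> regroups four Pauli entries, paired by projection on the left,
  according to tensor factors.\<close>

lemma sum_psi_proj_twirl:
  fixes A B :: "('n::finite \<Rightarrow> 2) cmat"
  shows "(\<Sum>\<mu>\<in>UNIV. cscale (trace (psi_proj \<mu> ** mtensor A B)) (psi_proj \<mu>)) =
    (\<Sum>\<mu>\<in>UNIV. (1 / 4 ^ CARD('n)) *\<^sub>R
      mtensor (transpose (pauli_string \<mu>) ** A ** transpose (pauli_string \<mu>))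
              (pauli_string \<mu> ** B ** pauli_string \<mu>))"
proof (intro vec_eq_iff[THEN iffD2] allI)
  fix i j :: "('n \<Rightarrow> 2) \<times> ('n \<Rightarrow> 2)"
  \<comment> \<open>The factors \<open>1 / 2^n\<close> of the two projections multiply to the weight
    of the average.\<close>
  have four: "(4::complex) ^ CARD('n) = 2 ^ CARD('n) * 2 ^ CARD('n)"
    by (simp flip: power_mult_distrib)
  let ?S = "pauli_string"
  have "(\<Sum>\<mu>\<in>UNIV. cscale (trace (psi_proj \<mu> ** mtensor A B)) (psi_proj \<mu>)) $ i $ j =
    (\<Sum>\<mu>\<in>UNIV. \<Sum>q\<in>UNIV. \<Sum>p\<in>UNIV. mtensor A B $ p $ q / 4 ^ CARD('n) *
     (?S \<mu> $ snd q $ fst q * ?S \<mu> $ fst p $ snd p * (?S \<mu> $ snd i $ fst i * ?S \<mu> $ fst j $ snd j)))"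
    by (simp add: cscale_def trace_def matrix_matrix_mult_def psi_proj_entries four
        sum_distrib_right sum_distrib_left sum_divide_distrib mult_ac)
  also have "\<dots> = (\<Sum>q\<in>UNIV. \<Sum>p\<in>UNIV. mtensor A B $ p $ q / 4 ^ CARD('n) * (\<Sum>\<mu>\<in>UNIV.
     (?S \<mu> $ snd q $ fst q * ?S \<mu> $ fst p $ snd p * (?S \<mu> $ snd i $ fst i * ?S \<mu> $ fst j $ snd j))))"
    unfolding sum_distrib_left by (rule sum_rotate)
  \<comment> \<open>Each Pauli entry now involves only first or only second components, so the sum
    over \<open>p\<close> and \<open>q\<close> can split into a product.\<close>
  also have "\<dots> = (\<Sum>q\<in>UNIV. \<Sum>p\<in>UNIV. mtensor A B $ p $ q / 4 ^ CARD('n) * (\<Sum>\<mu>\<in>UNIV.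
     (?S \<mu> $ fst p $ fst i * ?S \<mu> $ snd i $ snd p * (?S \<mu> $ fst j $ fst q * ?S \<mu> $ snd q $ snd j))))"
    by (subst pauli_string_twirl) (rule refl)
  also have "\<dots> = (\<Sum>\<mu>\<in>UNIV. \<Sum>q\<in>UNIV. \<Sum>p\<in>UNIV. mtensor A B $ p $ q / 4 ^ CARD('n) *
     (?S \<mu> $ fst p $ fst i * ?S \<mu> $ snd i $ snd p * (?S \<mu> $ fst j $ fst q * ?S \<mu> $ snd q $ snd j)))"
    unfolding sum_distrib_left by (rule sum_rotate[symmetric])
  also have "\<dots> = (\<Sum>\<mu>\<in>UNIV. (1 / 4 ^ CARD('n)) *
      ((\<Sum>b\<in>UNIV. \<Sum>a\<in>UNIV. ?S \<mu> $ a $ fst i * A $ a $ b * ?S \<mu> $ fst j $ b) *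
       (\<Sum>l\<in>UNIV. \<Sum>k\<in>UNIV. ?S \<mu> $ snd i $ k * B $ k $ l * ?S \<mu> $ l $ snd j)))"
  proof (intro sum.cong refl)
    fix \<mu> :: "'n \<Rightarrow> 4"
    let ?F = "\<lambda>a b. ?S \<mu> $ a $ fst i * A $ a $ b * ?S \<mu> $ fst j $ b"
    let ?G = "\<lambda>k l. ?S \<mu> $ snd i $ k * B $ k $ l * ?S \<mu> $ l $ snd j"
    have "(\<Sum>q\<in>UNIV. \<Sum>p\<in>UNIV. mtensor A B $ p $ q / 4 ^ CARD('n) *
     (?S \<mu> $ fst p $ fst i * ?S \<mu> $ snd i $ snd p * (?S \<mu> $ fst j $ fst q * ?S \<mu> $ snd q $ snd j)))
     = (\<Sum>b\<in>UNIV. \<Sum>l\<in>UNIV. \<Sum>a\<in>UNIV. \<Sum>k\<in>UNIV. (1 / 4 ^ CARD('n)) * (?F a b * ?G k l))"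
      by (simp add: sum_UNIV_prod mtensor_def mult_ac)
    also have "\<dots> = (1 / 4 ^ CARD('n)) * (\<Sum>b\<in>UNIV. \<Sum>l\<in>UNIV. (\<Sum>a\<in>UNIV. ?F a b) * (\<Sum>k\<in>UNIV. ?G k l))"
      unfolding sum_distrib_left[symmetric] sum_product ..
    also have "\<dots> = (1 / 4 ^ CARD('n)) * ((\<Sum>b\<in>UNIV. \<Sum>a\<in>UNIV. ?F a b) * (\<Sum>l\<in>UNIV. \<Sum>k\<in>UNIV. ?G k l))"
      unfolding sum_product ..
    finally show "(\<Sum>q\<in>UNIV. \<Sum>p\<in>UNIV. mtensor A B $ p $ q / 4 ^ CARD('n) *
     (?S \<mu> $ fst p $ fst i * ?S \<mu> $ snd i $ snd p * (?S \<mu> $ fst j $ fst q * ?S \<mu> $ snd q $ snd j)))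
     = (1 / 4 ^ CARD('n)) * ((\<Sum>b\<in>UNIV. \<Sum>a\<in>UNIV. ?F a b) * (\<Sum>l\<in>UNIV. \<Sum>k\<in>UNIV. ?G k l))" .
  qed
  also have "\<dots> = (\<Sum>\<mu>\<in>UNIV. (1 / 4 ^ CARD('n)) *\<^sub>R
      mtensor (transpose (pauli_string \<mu>) ** A ** transpose (pauli_string \<mu>))
              (pauli_string \<mu> ** B ** pauli_string \<mu>)) $ i $ j"
    by (simp add: mtensor_def matrix_matrix_mult_def transpose_def sum_distrib_right
        scaleR_conv_of_real[where 'a = complex])
  finally show "(\<Sum>\<mu>\<in>UNIV. cscale (trace (psi_proj \<mu> ** mtensor A B)) (psi_proj \<mu>)) $ i $ j =
    (\<Sum>\<mu>\<in>UNIV. (1 / 4 ^ CARD('n)) *\<^sub>R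
      mtensor (transpose (pauli_string \<mu>) ** A ** transpose (pauli_string \<mu>))
              (pauli_string \<mu> ** B ** pauli_string \<mu>)) $ i $ j" .
qed

lemma trace_psi_proj_mtensor_real:
  fixes A B :: "('n::finite \<Rightarrow> 2) cmat"
  assumes "psd A" "psd B"
  shows "trace (psi_proj \<mu> ** mtensor A B) = of_real (Re (trace (psi_proj \<mu> ** mtensor A B)))"
proof -
  have "cnj (trace (psi_proj \<mu> ** mtensor A B)) =
      (\<Sum>q\<in>UNIV. \<Sum>p\<in>UNIV. psi_proj \<mu> $ p $ q * mtensor A B $ q $ p)"
    by (simp add: trace_def matrix_matrix_mult_def psi_proj_entries mtensor_def
        pauli_string_hermitian psd_hermitian[OF assms(1)] psd_hermitian[OF assms(2)] mult_ac)
  also have "\<dots> = trace (psi_proj \<mu> ** mtensor A B)"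
    unfolding trace_def matrix_matrix_mult_def by (subst sum.swap) simp
  finally show ?thesis by (simp add: complex_eq_iff)
qed

text \<open>By \<open>sum_psi_proj_twirl\<close> the diagonal part is a uniform mixture of
  \<open>4^n\<close> product states. The coefficients are taken as real parts because convex
  combinations use real scalars.\<close>

lemma separable_state_psi_proj_twirl:
  fixes A B :: "('n::finite \<Rightarrow> 2) cmat"
  assumes "density_matrix A" and "density_matrix B"
  shows "separable_state (\<Sum>\<mu>\<in>UNIV. Re (trace (psi_proj \<mu> ** mtensor A B)) *\<^sub>R psi_proj \<mu>)"
    and "(\<Sum>\<mu>\<in>UNIV. Re (trace (psi_proj \<mu> ** mtensor A B))) = 1"
proof -
  let ?T = "\<Sum>\<mu>\<in>UNIV. Re (trace (psi_proj \<mu> ** mtensor A B)) *\<^sub>R psi_proj \<mu>"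
  let ?C = "\<lambda>\<mu>. transpose (pauli_string \<mu>) ** A ** transpose (pauli_string \<mu>)"
  let ?D = "\<lambda>\<mu>. pauli_string \<mu> ** B ** pauli_string \<mu>"
  have psd: "psd A" "psd B"
    using assms by (simp_all add: density_matrix_def)
  have "Re (trace (psi_proj \<mu> ** mtensor A B)) *\<^sub>R psi_proj \<mu>
      = cscale (trace (psi_proj \<mu> ** mtensor A B)) (psi_proj \<mu>)" for \<mu> :: "'n \<Rightarrow> 4"
    unfolding cscale_def by (subst (2) trace_psi_proj_mtensor_real[OF psd])
      (simp add: vec_eq_iff scaleR_conv_of_real[where 'a = complex])
  then have T: "?T = (\<Sum>\<mu>\<in>UNIV. (1 / 4 ^ CARD('n)) *\<^sub>R mtensor (?C \<mu>) (?D \<mu>))"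
    by (simp only: sum_psi_proj_twirl)
  have "transpose (pauli_string \<mu>) ** transpose (pauli_string \<mu>) = mat 1" for \<mu> :: "'n \<Rightarrow> 4"
    unfolding matrix_transpose_mul[symmetric] pauli_string_involution by (rule transpose_mat)
  then have C: "density_matrix (?C \<mu>)" for \<mu>
    using density_matrix_conjugate[OF assms(1), of "transpose (pauli_string \<mu>)"]
    by (simp add: transpose_def pauli_string_hermitian)
  have D: "density_matrix (?D \<mu>)" for \<mu>
    using assms(2)
    by (rule density_matrix_conjugate) (simp_all add: pauli_string_hermitian pauli_string_involution)
  show "separable_state ?T"
    unfolding T separable_state_def
  proof (rule convex_sum)
    show "mtensor (?C \<mu>) (?D \<mu>) \<in>
        convex hull {mtensor \<rho>1 \<rho>2 | \<rho>1 \<rho>2. density_matrix \<rho>1 \<and> density_matrix \<rho>2}" for \<mu>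
      using C D by (intro hull_inc) blast
  qed (simp_all add: card_fun convex_convex_hull)
  \<comment> \<open>The trace of \<open>?T\<close> is found twice: as that of a mixture of product
    states, and as the sum of the coefficients, each projection having trace one.\<close>
  have trace_sum: "trace (sum f UNIV) = (\<Sum>\<mu>\<in>UNIV. trace (f \<mu>))" for f :: "('n \<Rightarrow> 4) \<Rightarrow> (('n \<Rightarrow> 2) \<times> ('n \<Rightarrow> 2)) cmat"
    by (simp add: trace_def sum_component) (rule sum.swap)
  have "trace ?T = 1"
    unfolding T trace_sum using C D
    by (simp add: trace_scaleR trace_mtensor density_matrix_def card_fun
        scaleR_conv_of_real[where 'a = complex])
  moreover have "trace ?T = of_real (\<Sum>\<mu>\<in>UNIV. Re (trace (psi_proj \<mu> ** mtensor A B)))"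
    unfolding trace_sum by (simp add: trace_scaleR trace_psi_proj
        scaleR_conv_of_real[where 'a = complex])
  ultimately show "(\<Sum>\<mu>\<in>UNIV. Re (trace (psi_proj \<mu> ** mtensor A B))) = 1"
    by (simp only: of_real_eq_1_iff)
qed

section \<open>Quadratic forms at the maximally entangled vectors\<close>

lemma psi_orthonormal:
  fixes \<mu> \<nu> :: "'n::finite \<Rightarrow> 4"
  shows "(\<Sum>i\<in>UNIV. cnj (psi \<nu> $ i) * psi \<mu> $ i) = (if \<mu> = \<nu> then 1 else 0)"
proof -
  have "(\<Sum>i\<in>UNIV. cnj (psi \<nu> $ i) * psi \<mu> $ i) =
     (\<Sum>i\<in>UNIV. pauli_string \<nu> $ fst i $ snd i * pauli_string \<mu> $ snd i $ fst i) / 2 ^ CARD('n)"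
    using normalization_squared[of "CARD('n)"]
    by (simp add: psi_entries pauli_string_hermitian sum_divide_distrib)
  also have "\<dots> = (if \<mu> = \<nu> then 1 else 0)"
    using pauli_string_orthogonal[of \<nu> \<mu>]
    by (simp add: sum_UNIV_prod)
  finally show ?thesis .
qed


lemma psi_plus_form:
  fixes M :: "(('n::finite \<Rightarrow> 2) \<times> ('n \<Rightarrow> 2)) cmat"
  shows "(\<Sum>i\<in>UNIV. cnj (psi_plus $ i) * (M *v psi_plus) $ i) =
    (\<Sum>a\<in>UNIV. \<Sum>b\<in>UNIV. M $ (a, a) $ (b, b)) / 2 ^ CARD('n)"
proof -
  let ?k = "complex_of_real (1 / sqrt (2 ^ CARD('n)))"
  have "(M *v psi_plus) $ i = (\<Sum>b\<in>UNIV. M $ i $ (b, b) * ?k)" for i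
    unfolding matrix_vector_mult_def sum_UNIV_prod psi_plus_entries
    by (simp add: if_distrib[of "\<lambda>x. _ * x"] cong: if_cong)
  then have "(\<Sum>i\<in>UNIV. cnj (psi_plus $ i) * (M *v psi_plus) $ i) =
     (\<Sum>a\<in>UNIV. ?k * (\<Sum>b\<in>UNIV. M $ (a, a) $ (b, b) * ?k))"
    unfolding sum_UNIV_prod psi_plus_entries
    by (simp add: if_distrib[of cnj] if_distrib[of "\<lambda>x. x * _"] if_distrib[of "\<lambda>x. x / _"] cong: if_cong)
  also have "\<dots> = (\<Sum>a\<in>UNIV. \<Sum>b\<in>UNIV. M $ (a, a) $ (b, b)) * (?k * ?k)"
    by (simp only: sum_distrib_left sum_distrib_right mult_ac)
  finally show ?thesis by (simp only: normalization_squared times_divide_eq_right mult_1_right)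
qed

text \<open>The right side is \<open>psi_plus_form\<close> for \<open>M\<close> with every block
  conjugated by the Hermitian \<open>pauli_string \<nu>\<close>. So a Pauli conjugation on the
  second factor can be moved onto the test vector.\<close>

lemma psi_form:
  fixes M :: "(('n::finite \<Rightarrow> 2) \<times> ('n \<Rightarrow> 2)) cmat"
  shows "(\<Sum>i\<in>UNIV. \<Sum>j\<in>UNIV. cnj (psi \<nu> $ i) * M $ i $ j * psi \<nu> $ j) =
    (\<Sum>a\<in>UNIV. \<Sum>b\<in>UNIV. (pauli_string \<nu> ** block a b M ** pauli_string \<nu>) $ a $ b) / 2 ^ CARD('n)"
proof -
  define k where "k = complex_of_real (1 / sqrt (2 ^ CARD('n)))"
  have cnj_k: "cnj k = k"
    by (simp add: k_def)
  let ?S = "\<lambda>a b. pauli_string \<nu> $ a $ b"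
  have "(\<Sum>i\<in>UNIV. \<Sum>j\<in>UNIV. cnj (psi \<nu> $ i) * M $ i $ j * psi \<nu> $ j) =
     (\<Sum>i\<in>UNIV. \<Sum>j\<in>UNIV. ?S (fst i) (snd i) * M $ i $ j * ?S (snd j) (fst j) * (k * k))"
    unfolding psi_entries k_def[symmetric] complex_cnj_mult pauli_string_hermitian
    by (simp only: mult_ac cnj_k)
  also have "\<dots> = (\<Sum>i\<in>UNIV. \<Sum>j\<in>UNIV. ?S (fst i) (snd i) * M $ i $ j * ?S (snd j) (fst j)) / 2 ^ CARD('n)"
    unfolding k_def normalization_squared by (simp add: sum_divide_distrib)
  also have "(\<Sum>i\<in>UNIV. \<Sum>j\<in>UNIV. ?S (fst i) (snd i) * M $ i $ j * ?S (snd j) (fst j)) =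
     (\<Sum>a\<in>UNIV. \<Sum>p\<in>UNIV. \<Sum>b\<in>UNIV. \<Sum>q\<in>UNIV. ?S a p * M $ (a, p) $ (b, q) * ?S q b)"
    by (simp add: sum_UNIV_prod)
  also have "\<dots> = (\<Sum>a\<in>UNIV. \<Sum>b\<in>UNIV. \<Sum>q\<in>UNIV. \<Sum>p\<in>UNIV. ?S a p * M $ (a, p) $ (b, q) * ?S q b)"
    by (intro sum.cong refl sum_rotate)
  also have "\<dots> = (\<Sum>a\<in>UNIV. \<Sum>b\<in>UNIV. (pauli_string \<nu> ** block a b M ** pauli_string \<nu>) $ a $ b)"
    by (simp add: matrix_matrix_mult_def block_def sum_distrib_right)
  finally show ?thesis .
qed

lemma psi_form_psi_proj:
  "(\<Sum>i\<in>UNIV. \<Sum>j\<in>UNIV. cnj (psi \<nu> $ i) * psi_proj \<mu> $ i $ j * psi \<nu> $ j) = (if \<mu> = \<nu> then 1 else 0)"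
proof -
  have "(\<Sum>i\<in>UNIV. \<Sum>j\<in>UNIV. cnj (psi \<nu> $ i) * psi_proj \<mu> $ i $ j * psi \<nu> $ j) =
     (\<Sum>i\<in>UNIV. cnj (psi \<nu> $ i) * psi \<mu> $ i) * (\<Sum>j\<in>UNIV. cnj (psi \<mu> $ j) * psi \<nu> $ j)"
    by (simp add: psi_proj_def ketbra_def sum_product mult_ac)
  then show ?thesis by (simp add: psi_orthonormal)
qed


subsection \<open>The diagonal witness\<close>

lemma clinear_map_conjugate_sum:
  fixes U :: "'m::finite \<Rightarrow> 'i::finite cmat"
  shows "clinear_map (\<lambda>X. \<Sum>\<mu>\<in>UNIV. cscale (c \<mu>) (U \<mu> ** X ** U \<mu>))"
proof -
  have add: "U \<mu> ** (X + Y) ** U \<mu> = U \<mu> ** X ** U \<mu> + U \<mu> ** Y ** U \<mu>" for \<mu> X Y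
    unfolding matrix_add_ldistrib
    by (simp add: vec_eq_iff matrix_matrix_mult_def distrib_right sum.distrib)
  have scale: "U \<mu> ** cscale a X ** U \<mu> = cscale a (U \<mu> ** X ** U \<mu>)" for \<mu> a X
    by (simp add: vec_eq_iff cscale_def matrix_matrix_mult_def sum_distrib_left sum_distrib_right
        mult.left_commute mult.assoc)
  show ?thesis
    unfolding clinear_map_def add scale
    by (simp add: vec_eq_iff cscale_def sum.distrib sum_distrib_left distrib_left mult.left_commute)
qed

theorem proposition4:
  fixes r :: "('n::finite \<Rightarrow> 4) \<Rightarrow> real"
    and \<rho> :: "(('n \<Rightarrow> 2) \<times> ('n \<Rightarrow> 2)) cmat"
  assumes "\<And>\<mu>. 0 \<le> r \<mu> \<and> r \<mu> \<le> 1"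
    and "(\<Sum>\<mu>\<in>UNIV. r \<mu>) = 1"
    and "\<rho> = (\<Sum>\<mu>\<in>UNIV. r \<mu> *\<^sub>R psi_proj \<mu>)"
    and "entangled \<rho>"
  shows "\<exists>(\<Lambda> :: ('n \<Rightarrow> 2) cmat \<Rightarrow> ('n \<Rightarrow> 2) cmat) (lam :: ('n \<Rightarrow> 4) \<Rightarrow> complex).
           positive_map \<Lambda> \<and>
           (\<forall>X. \<Lambda> X = (\<Sum>\<mu>\<in>UNIV. cscale (lam \<mu>) (pauli_string \<mu> ** X ** pauli_string \<mu>))) \<and>
           \<not> psd (id_tensor \<Lambda> \<rho>)"
proof -
  let ?Sep = "{\<rho> :: (('n \<Rightarrow> 2) \<times> ('n \<Rightarrow> 2)) cmat. separable_state \<rho>}"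
  have "convex ?Sep" "closed ?Sep" "\<rho> \<notin> ?Sep"
    using assms(4) compact_imp_closed[OF compact_separable_states]
    by (simp_all add: separable_state_def entangled_def convex_convex_hull)
  \<comment> \<open>Here \<open>inner\<close> is the real part of the Hilbert-Schmidt product, so
    the separation is one of real vector spaces.\<close>
  then obtain W c where W: "inner W \<rho> < c" "\<And>s. separable_state s \<Longrightarrow> c < inner W s"
    using separating_hyperplane_closed_point[of ?Sep \<rho>] by auto
  \<comment> \<open>As each projection has trace one, subtracting \<open>c\<close> amounts to
    replacing \<open>W\<close> by \<open>W - c *\<^sub>R mat 1\<close>, which moves the separating
    hyperplane to the origin.\<close>
  define w :: "('n \<Rightarrow> 4) \<Rightarrow> real" where "w \<mu> = inner W (psi_proj \<mu>) - c" for \<mu>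
  define lam where "lam \<mu> = complex_of_real (w \<mu>)" for \<mu>
  define \<Lambda> where "\<Lambda> X = (\<Sum>\<mu>\<in>UNIV. cscale (lam \<mu>) (pauli_string \<mu> ** X ** pauli_string \<mu>))" for X
  have w_sum: "(\<Sum>\<mu>\<in>UNIV. t \<mu> * w \<mu>) = inner W (\<Sum>\<mu>\<in>UNIV. t \<mu> *\<^sub>R psi_proj \<mu>) - c"
    if "(\<Sum>\<mu>\<in>UNIV. t \<mu>) = 1" for t
    using that by (simp add: w_def right_diff_distrib sum_subtractf inner_sum_right
        flip: sum_distrib_right)
  have w_\<rho>: "(\<Sum>\<mu>\<in>UNIV. r \<mu> * w \<mu>) < 0"
    using W(1) assms(2,3) by (simp add: w_sum)
  have density: "(\<Sum>\<mu>\<in>UNIV. lam \<mu> * trace (psi_proj \<mu> ** mtensor A B)) \<in> \<real>\<^sub>\<ge>\<^sub>0"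
    if "density_matrix A" "density_matrix B" for A B
  proof -
    \<comment> \<open>The coefficients sum to one, so \<open>w_sum\<close> turns this sum into the
      value of \<open>W\<close> at a separable state minus \<open>c\<close>.\<close>
    have "0 < (\<Sum>\<mu>\<in>UNIV. Re (trace (psi_proj \<mu> ** mtensor A B)) * w \<mu>)"
      using W(2) separable_state_psi_proj_twirl[OF that] by (simp add: w_sum)
    moreover have "(\<Sum>\<mu>\<in>UNIV. lam \<mu> * trace (psi_proj \<mu> ** mtensor A B))
        = of_real (\<Sum>\<mu>\<in>UNIV. Re (trace (psi_proj \<mu> ** mtensor A B)) * w \<mu>)"
      using that unfolding density_matrix_def
      by (subst trace_psi_proj_mtensor_real) (auto simp: lam_def mult.commute)
    ultimately show ?thesis
      by (simp only: nonneg_Reals_of_real_iff less_imp_le)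
  qed
  \<comment> \<open>The expression is bilinear in \<open>A\<close> and \<open>B\<close>: it vanishes
    if one of them is zero, and otherwise the traces can be factored out.\<close>
  have product: "(\<Sum>\<mu>\<in>UNIV. lam \<mu> * trace (psi_proj \<mu> ** mtensor A B)) \<in> \<real>\<^sub>\<ge>\<^sub>0"
    if "psd A" "psd B" for A B
    using that(1)
  proof (cases A rule: psd_cases)
    case 1
    then show ?thesis by (simp add: mtensor_def trace_def matrix_matrix_mult_def)
  next
    case (2 s A')
    note A' = this
    show ?thesis using that(2)
    proof (cases B rule: psd_cases)
      case 1
      then show ?thesis by (simp add: mtensor_def trace_def matrix_matrix_mult_def)
    next
      case (2 t B')
      have "(\<Sum>\<mu>\<in>UNIV. lam \<mu> * trace (psi_proj \<mu> ** mtensor A B)) =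
        of_real (s * t) * (\<Sum>\<mu>\<in>UNIV. lam \<mu> * trace (psi_proj \<mu> ** mtensor A' B'))"
        unfolding A'(3) 2(3)
        by (simp add: mtensor_def trace_def matrix_matrix_mult_def
            scaleR_conv_of_real[where 'a = complex] sum_distrib_left mult_ac)
      moreover have "complex_of_real (s * t) \<in> \<real>\<^sub>\<ge>\<^sub>0"
        using A'(1) 2(1) by (simp del: of_real_mult)
      ultimately show ?thesis
        using density[OF A'(2) 2(2)] by (simp del: of_real_mult)
    qed
  qed
  have "psd (\<Lambda> X)" if "psd X" for X
    unfolding psd_def
  proof
    fix y :: "complex ^ ('n \<Rightarrow> 2)"
    let ?Y = "ketbra (\<chi> i. cnj (y $ i)) (\<chi> i. cnj (y $ i))"
    have "(\<Sum>i\<in>UNIV. cnj (y $ i) * (\<Lambda> X *v y) $ i) =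
        (\<Sum>i\<in>UNIV. \<Sum>\<mu>\<in>UNIV. lam \<mu> * (cnj (y $ i) * ((pauli_string \<mu> ** X ** pauli_string \<mu>) *v y) $ i))"
    proof (intro sum.cong refl)
      fix i
      have "(\<Lambda> X *v y) $ i = (\<Sum>\<mu>\<in>UNIV. lam \<mu> * ((pauli_string \<mu> ** X ** pauli_string \<mu>) *v y) $ i)"
        unfolding matrix_vector_mult_def \<Lambda>_def
        by (simp add: cscale_def sum_distrib_right sum_distrib_left mult_ac) (rule sum.swap)
      then show "cnj (y $ i) * (\<Lambda> X *v y) $ i =
        (\<Sum>\<mu>\<in>UNIV. lam \<mu> * (cnj (y $ i) * ((pauli_string \<mu> ** X ** pauli_string \<mu>) *v y) $ i))"
        by (simp add: sum_distrib_left mult_ac)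
    qed
    also have "\<dots> = 2 ^ CARD('n) * (\<Sum>\<mu>\<in>UNIV. lam \<mu> * trace (psi_proj \<mu> ** mtensor ?Y X))"
      unfolding trace_psi_proj_mtensor by (subst sum.swap) (simp add: sum_distrib_left sum_divide_distrib)
    also have "\<dots> \<in> \<real>\<^sub>\<ge>\<^sub>0"
      using product[OF psd_ketbra that] by simp
    finally show "(\<Sum>i\<in>UNIV. cnj (y $ i) * (\<Lambda> X *v y) $ i) \<in> \<real>\<^sub>\<ge>\<^sub>0" .
  qed
  moreover have "clinear_map \<Lambda>"
    unfolding \<Lambda>_def by (rule clinear_map_conjugate_sum)
  ultimately have "positive_map \<Lambda>"
    by (simp add: positive_map_def)
  moreover have "\<not> psd (id_tensor \<Lambda> \<rho>)"
  proof
    assume "psd (id_tensor \<Lambda> \<rho>)"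
    then have "(\<Sum>i\<in>UNIV. cnj (psi_plus $ i) * (id_tensor \<Lambda> \<rho> *v psi_plus) $ i) \<in> \<real>\<^sub>\<ge>\<^sub>0"
      by (simp add: psd_def)
    \<comment> \<open>The Pauli strings in \<open>\<Lambda>\<close> pass from \<open>\<rho>\<close>
      to the test vector and turn \<open>psi_plus\<close> into the vectors
      \<open>psi \<nu>\<close>.\<close>
    also have "(\<Sum>i\<in>UNIV. cnj (psi_plus $ i) * (id_tensor \<Lambda> \<rho> *v psi_plus) $ i)
        = (\<Sum>\<nu>\<in>UNIV. lam \<nu> * (\<Sum>i\<in>UNIV. \<Sum>j\<in>UNIV. cnj (psi \<nu> $ i) * \<rho> $ i $ j * psi \<nu> $ j))"
      unfolding psi_plus_form psi_form
      by (simp add: id_tensor_def \<Lambda>_def cscale_def sum_distrib_left sum_divide_distrib)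
        (rule sum_rotate[symmetric])
    also have "\<dots> = (\<Sum>\<nu>\<in>UNIV. lam \<nu> * of_real (r \<nu>))"
    proof (intro sum.cong refl arg_cong2[where f = "(*)"])
      fix \<nu> :: "'n \<Rightarrow> 4"
      have "(\<Sum>i\<in>UNIV. \<Sum>j\<in>UNIV. cnj (psi \<nu> $ i) * \<rho> $ i $ j * psi \<nu> $ j) =
        (\<Sum>i\<in>UNIV. \<Sum>j\<in>UNIV. \<Sum>\<mu>\<in>UNIV.
           of_real (r \<mu>) * (cnj (psi \<nu> $ i) * psi_proj \<mu> $ i $ j * psi \<nu> $ j))"
        by (simp add: assms(3) scaleR_conv_of_real[where 'a = complex] sum_distrib_left
            sum_distrib_right mult_ac)
      also have "\<dots> = (\<Sum>\<mu>\<in>UNIV. of_real (r \<mu>) *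
           (\<Sum>i\<in>UNIV. \<Sum>j\<in>UNIV. cnj (psi \<nu> $ i) * psi_proj \<mu> $ i $ j * psi \<nu> $ j))"
        unfolding sum_distrib_left by (rule sum_rotate[symmetric])
      \<comment> \<open>Orthonormality leaves only the term with index \<open>\<nu>\<close>.\<close>
      also have "\<dots> = of_real (r \<nu>)"
        unfolding psi_form_psi_proj
        by (simp add: if_distrib[of "\<lambda>x. _ * x"] cong: if_cong)
      finally show "(\<Sum>i\<in>UNIV. \<Sum>j\<in>UNIV. cnj (psi \<nu> $ i) * \<rho> $ i $ j * psi \<nu> $ j) = of_real (r \<nu>)" .
    qed
    also have "\<dots> = of_real (\<Sum>\<mu>\<in>UNIV. r \<mu> * w \<mu>)"
      by (simp add: lam_def mult.commute)
    finally show False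
      using w_\<rho> unfolding nonneg_Reals_of_real_iff by linarith
  qed
  ultimately show ?thesis
    using \<Lambda>_def by blast
qed

end
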